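(* Let $b>0$. The following statements hold. I: For each $f\in PW_b^\star$ and each $c\in\mathbb{R}$, the function $t\mapsto f(t+ic)$ is uniformly Lipschitz continuous on $\mathbb{R}$. II: For any fixed numbers $c,c'\in\mathbb{C}$, there are positive constants $C_1,C_2$ such that $C_1\|f\|_{BMO,c'}\le\|f\|_{BMO,c}\le C_2\|f\|_{BMO,c'}$ for all $f\in PW_b^\star$. III: For any given $z\in\mathbb{C}$, the point evaluation functional $f\mapsto f(z)$ is bounded on $PW_b^\star$. IV: There is a constant $C$ such that $\|f'\|_{L^\infty(\mathbb{R})}\le C\|f\|_{BMO}$ for all $f\in PW_b^\star$.
   Context: The type of an entire function $f$ is $\mathrm{type}(f)=\inf\{\beta: \text{there is } C \text{ with } |f(z)|\le Ce^{\beta|z|}\text{ for all }z\in\mathbb{C}\}$ (with $\mathrm{type}(f)=\infty$ if no such $\beta$ exists or $f$ is not entire). For a locally integrable function $f$ on $\mathbb{R}$, $$\|f\|_{BMO}=\sup_I\frac{1}{|I|}\int_I\left|f(t)-\frac{1}{|I|}\int_If(s)\,ds\right|dt,$$ the supremum being over all bounded real intervals $I$; for entire $f$ this is applied to the restriction of $f$ to $\mathbb{R}$. For a point $c$, put $\|f\|_{BMO,c}=|f(c)|+\|f\|_{BMO}$. Fixing a point $c$, the space $PW_b^\star$ is $$PW_b^\star=\{f:\ \mathrm{type}(f)\le\pi b,\ \|f\|_{BMO,c}<\infty\},$$ normed by $\|\cdot\|_{BMO,c}$ (as a set it does not depend on $c$, since $f$ is entire). *)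

theory Defs
  imports "HOL-Analysis.Analysis" "HOL-Probability.Essential_Supremum"
begin

text \<open>The infimum is taken in \<^typ>\<open>ereal\<close>, so it is \<open>\<infinity>\<close> if there is no admissible \<open>\<beta>\<close>; for
  \<open>f = 0\<close> every real \<open>\<beta>\<close> is admissible and the type is \<open>-\<infinity>\<close>.\<close>

definition exp_type :: "(complex \<Rightarrow> complex) \<Rightarrow> ereal" where
  "exp_type f =
     (if f holomorphic_on UNIV
      then Inf {ereal \<beta> | \<beta>. \<exists>C::real. \<forall>z. norm (f z) \<le> C * exp (\<beta> * norm z)}
      else \<infinity>)"

definition mean_on :: "real set \<Rightarrow> (real \<Rightarrow> complex) \<Rightarrow> complex" where
  "mean_on I f = (LINT t:I|lborel. f t) / complex_of_real (measure lborel I)"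

text \<open>Meaningful only for locally integrable \<open>f\<close>. Intervals may be open, closed or half-open;
  those of length 0 are excluded because the averages over them are undefined.\<close>

definition bmo_norm :: "(real \<Rightarrow> complex) \<Rightarrow> ennreal" where
  "bmo_norm f =
     (SUP I \<in> {I. is_interval I \<and> bounded I \<and> emeasure lborel I > 0}.
        (\<integral>\<^sup>+t\<in>I. ennreal (norm (f t - mean_on I f)) \<partial>lborel) / emeasure lborel I)"

abbreviation bmo_norm_entire :: "(complex \<Rightarrow> complex) \<Rightarrow> ennreal" where
  "bmo_norm_entire f \<equiv> bmo_norm (\<lambda>t. f (complex_of_real t))"

definition bmo_norm_at :: "complex \<Rightarrow> (complex \<Rightarrow> complex) \<Rightarrow> ennreal" where
  "bmo_norm_at c f = ennreal (norm (f c)) + bmo_norm_entire f"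

definition PW_star :: "complex \<Rightarrow> real \<Rightarrow> (complex \<Rightarrow> complex) set" where
  "PW_star c b = {f. exp_type f \<le> ereal (pi * b) \<and> bmo_norm_at c f < \<infinity>}"

definition Linfty_norm :: "(real \<Rightarrow> complex) \<Rightarrow> ennreal" where
  "Linfty_norm g = esssup lborel (\<lambda>t. ennreal (norm (g t)))"

end

theory Submission
  imports Defs "HOL-Complex_Analysis.Complex_Analysis" "HOL-Real_Asymp.Real_Asymp"
begin

text \<open>All four statements follow from one estimate: there are \<open>K\<close> and \<open>\<sigma>\<close>, depending only on \<open>b\<close>, with
  \<open>\<bar>f'(z)\<bar> \<le> K exp (\<sigma>\<bar>Im z\<bar>) \<parallel>f\<parallel>\<close> for all \<open>f\<close> in the space and all \<open>z\<close>, where \<open>\<parallel>f\<parallel>\<close> is the \<open>BMO\<close> norm. On the real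
  line it is the bound on \<open>f'\<close>; on a horizontal line it is Lipschitz continuity; integrated along a segment from
  \<open>c'\<close> to \<open>c\<close> it gives \<open>\<bar>f(c) - f(c')\<bar> \<le> const \<cdot> \<parallel>f\<parallel>\<close>, hence the equivalence of the norms and the boundedness
  of point evaluations.

  The estimate uses no Fourier analysis. Let \<open>P\<close> be a primitive of \<open>f\<close>. Its second difference
  \<open>P(x + 2h) - 2P(x + h) + P(x)\<close> compares the integrals of \<open>f\<close> over two adjacent intervals of length \<open>h\<close>, so it
  is at most \<open>4 h \<parallel>f\<parallel>\<close> (\<open>second_difference_primitive_le_bmo_norm\<close>). On the other hand it is close to
  \<open>h\<^sup>2 P''(x) = h\<^sup>2 f'(x)\<close>, with an error controlled by \<open>h\<^sup>3 sup \<bar>f''\<bar>\<close>. For bounded functions of exponential type \<open>\<sigma>\<close>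
  differentiation has norm \<open>O(\<sigma>)\<close>, so for \<open>h\<close> a small multiple of \<open>1/\<sigma>\<close> the error is at most half of
  \<open>h\<^sup>2 sup \<bar>f'\<bar>\<close> and can be absorbed.

  Absorption requires \<open>sup \<bar>f'\<bar>\<close> to be finite, which is not known beforehand. It is replaced by the supremum of
  \<open>\<bar>f'(x)\<bar> / (1 + \<epsilon>\<^sup>2x\<^sup>2)\<close>: bounded second differences force \<open>P\<close>, and through the Phragmen--Lindeloef principle
  and Cauchy's estimates also \<open>P''\<close>, to grow at most quadratically on the line, so this supremum is finite. The
  Phragmen--Lindeloef principle with the weight \<open>\<bar>1 - \<i>\<epsilon>z\<bar>\<^sup>2\<close> (\<open>phragmen_lindelof_weighted\<close>) gives the norm bound for
  differentiation uniformly in \<open>\<epsilon>\<close>; so does the absorbed bound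
  (\<open>second_derivative_le_second_difference\<close>), and \<open>\<epsilon>\<close> tends to 0.\<close>

section \<open>Phragmen--Lindeloef principles\<close>

text \<open>The frontier of \<open>S\<close> need not be computed: any open \<open>W \<subseteq> S\<close>, given by strict inequalities, say, lies in the
  interior, so that the frontier is contained in \<open>S - W\<close>.\<close>

lemma maximum_modulus_open_part:
  assumes "closed S" "bounded S" and "open W" "W \<subseteq> S"
    and "open U" "S \<subseteq> U" "f holomorphic_on U"
    and bound: "\<And>z. z \<in> S - W \<Longrightarrow> norm (f z) \<le> B" and "z \<in> S"
  shows "norm (f z) \<le> B"
proof (rule maximum_modulus_frontier[of f S])
  show "f holomorphic_on interior S"
    using assms interior_subset by (metis holomorphic_on_subset subset_trans)
  show "continuous_on (closure S) f"
    using assms by (metis closure_closed continuous_on_subset holomorphic_on_imp_continuous_on)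
  show "norm (f w) \<le> B" if "w \<in> frontier S" for w
    using that interior_maximal[OF \<open>W \<subseteq> S\<close> \<open>open W\<close>] \<open>closed S\<close>
    by (intro bound) (auto simp: frontier_def)
qed (use assms in auto)

text \<open>The barrier is \<open>exp (- \<delta> (1 - 2\<i>) w\<^sup>3)\<close>. With \<open>w = x + \<i>y\<close> and \<open>0 \<le> y \<le> x\<close> one has
  \<open>Re ((1 - 2\<i>) w\<^sup>3) \<ge> x\<^sup>3 \<ge> \<bar>w\<bar>\<^sup>3 / 8\<close>: the cube maps the sector of opening \<open>\<pi>/4\<close> onto one of opening
  \<open>3\<pi>/4 < \<pi>\<close>, which the factor \<open>1 - 2\<i>\<close> turns into the open right half-plane. The barrier thus
  beats growth of order 2 and has modulus at most 1 on the boundary rays. Working in this sector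
  rather than in the quadrant keeps the barrier a polynomial exponential, free of fractional powers.\<close>

lemma phragmen_lindelof_sector:
  assumes "open U" "f holomorphic_on U" and U: "{w. 0 \<le> Im w \<and> Im w \<le> Re w} \<subseteq> U"
    and growth: "\<And>w. 0 \<le> Im w \<Longrightarrow> Im w \<le> Re w \<Longrightarrow> norm (f w) \<le> C * exp (\<beta> * norm w ^ 2)"
    and bottom: "\<And>w. Im w = 0 \<Longrightarrow> 0 \<le> Re w \<Longrightarrow> norm (f w) \<le> K"
    and top: "\<And>w. Im w = Re w \<Longrightarrow> 0 \<le> Re w \<Longrightarrow> norm (f w) \<le> K"
    and "0 \<le> Im w0" "Im w0 \<le> Re w0"
  shows "norm (f w0) \<le> K"
proof -
  define q where "q = (\<lambda>w. Re ((1 - 2 * \<i>) * w ^ 3))"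
  have q_eq: "q w = Re w ^ 3 + 6 * Re w ^ 2 * Im w - 3 * Re w * Im w ^ 2 - 2 * Im w ^ 3" for w
    by (simp add: q_def power3_eq_cube power2_eq_square algebra_simps)
  have q_ge: "norm w ^ 3 / 8 \<le> q w" if "0 \<le> Im w" "Im w \<le> Re w" for w
  proof -
    have "norm w \<le> 2 * Re w"
      using cmod_le[of w] that by simp
    then have "norm w ^ 3 \<le> (2 * Re w) ^ 3"
      by (intro power_mono) auto
    moreover have "Re w * Im w ^ 2 \<le> Re w * (Re w * Im w)" "Im w ^ 3 \<le> Re w ^ 2 * Im w"
      using that mult_mono[of "Im w" "Re w" "Im w" "Re w"]
      by (auto simp: power2_eq_square power3_eq_cube intro!: mult_left_mono mult_right_mono)
    moreover have "0 \<le> Re w ^ 2 * Im w"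
      using that by simp
    ultimately show ?thesis
      unfolding q_eq by (simp add: power2_eq_square power3_eq_cube)
  qed
  have "0 \<le> K"
    using bottom[of 0] norm_ge_zero[of "f 0"] by (simp del: norm_ge_zero)
  have "0 \<le> C"
    using growth[of 0] norm_ge_zero[of "f 0"] by (simp del: norm_ge_zero)
  have *: "norm (f w0) \<le> (K + \<delta>) * exp (\<delta> * q w0)" if "\<delta> > 0" for \<delta> :: real
  proof -
    have "((\<lambda>R. C * exp (\<beta> * R ^ 2 - \<delta> * (R ^ 3 / 8))) \<longlongrightarrow> 0) at_top"
    proof -
      have "filterlim (\<lambda>R. \<beta> * R ^ 2 - \<delta> * (R ^ 3 / 8)) at_bot at_top"
        using \<open>\<delta> > 0\<close> by real_asymp
      then have "((\<lambda>R. exp (\<beta> * R ^ 2 - \<delta> * (R ^ 3 / 8))) \<longlongrightarrow> 0) at_top"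
        by (rule filterlim_compose[OF exp_at_bot])
      then show ?thesis
        using tendsto_mult_right_zero[where c = C] by simp
    qed
    then have "\<forall>\<^sub>F R in at_top. C * exp (\<beta> * R ^ 2 - \<delta> * (R ^ 3 / 8)) < \<delta>"
      using \<open>\<delta> > 0\<close> by (rule order_tendstoD)
    then have "\<forall>\<^sub>F R in at_top. norm w0 \<le> R \<and> C * exp (\<beta> * R ^ 2 - \<delta> * (R ^ 3 / 8)) < \<delta>"
      using eventually_ge_at_top[of "norm w0"] by eventually_elim auto
    then obtain R where R: "norm w0 \<le> R" "C * exp (\<beta> * R ^ 2 - \<delta> * (R ^ 3 / 8)) < \<delta>"
      using eventually_happens'[OF trivial_limit_at_top_linorder] by blast
    define F where "F = (\<lambda>w. f w * exp (- (of_real \<delta> * ((1 - 2 * \<i>) * w ^ 3))))"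
    have norm_F: "norm (F w) = norm (f w) * exp (- (\<delta> * q w))" for w
      unfolding F_def norm_mult norm_exp_eq_Re q_def by simp
    let ?S = "cball 0 R \<inter> ({w. 0 \<le> Im w} \<inter> {w. Im w \<le> Re w})"
    let ?W = "ball 0 R \<inter> ({w. 0 < Im w} \<inter> {w. Im w < Re w})"
    have "norm (F w0) \<le> K + \<delta>"
    proof (rule maximum_modulus_open_part[of ?S ?W U F _ w0])
      show "closed ?S"
        by (intro closed_Int closed_cball closed_Collect_le continuous_intros)
      show "open ?W"
        by (intro open_Int open_ball open_Collect_less continuous_intros)
      show "F holomorphic_on U"
        unfolding F_def by (intro holomorphic_intros assms)
      show "norm (F w) \<le> K + \<delta>" if w: "w \<in> ?S - ?W" for w
      proof -
        have "0 \<le> q w"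
          using q_ge[of w] w order_trans[of 0 "norm w ^ 3 / 8" "q w"] by simp
        then have e: "exp (- (\<delta> * q w)) \<le> 1"
          using \<open>\<delta> > 0\<close> by simp
        consider "norm w = R" | "Im w = 0" | "Im w = Re w"
          using w by (auto simp: not_less)
        then show ?thesis
        proof cases
          case 1
          have "norm (f w) \<le> C * exp (\<beta> * R ^ 2)" "\<delta> * (R ^ 3 / 8) \<le> \<delta> * q w"
            using growth[of w] mult_left_mono[OF q_ge[of w], of \<delta>] w 1 \<open>\<delta> > 0\<close> by auto
          then have "norm (F w) \<le> (C * exp (\<beta> * R ^ 2)) * exp (- (\<delta> * (R ^ 3 / 8)))"
            unfolding norm_F using \<open>0 \<le> C\<close> by (intro mult_mono) simp_all
          also have "\<dots> = C * exp (\<beta> * R ^ 2 - \<delta> * (R ^ 3 / 8))"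
            by (simp add: mult.assoc flip: exp_add)
          finally show ?thesis
            using R \<open>0 \<le> K\<close> by simp
        next
          case 2
          then have "norm (F w) \<le> K * 1"
            unfolding norm_F using w e \<open>0 \<le> K\<close> by (intro mult_mono bottom) auto
          then show ?thesis using \<open>\<delta> > 0\<close> by simp
        next
          case 3
          then have "norm (F w) \<le> K * 1"
            unfolding norm_F using w e \<open>0 \<le> K\<close> by (intro mult_mono top) auto
          then show ?thesis using \<open>\<delta> > 0\<close> by simp
        qed
      qed
      show "bounded ?S"
        by (intro bounded_Int disjI1 bounded_cball)
      show "?W \<subseteq> ?S" by auto
      show "?S \<subseteq> U" using U by blast
      show "w0 \<in> ?S" using R \<open>0 \<le> Im w0\<close> \<open>Im w0 \<le> Re w0\<close> by simp
    qed (rule \<open>open U\<close>)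
    then show ?thesis
      by (simp add: norm_F exp_minus field_simps)
  qed
  have "((\<lambda>\<delta>. (K + \<delta>) * exp (\<delta> * q w0)) \<longlongrightarrow> (K + 0) * exp (0 * q w0)) (at_right 0)"
    by (intro tendsto_intros)
  moreover have "\<forall>\<^sub>F \<delta> in at_right 0. norm (f w0) \<le> (K + \<delta>) * exp (\<delta> * q w0)"
    using * by (auto intro: eventually_at_rightI[of 0 1])
  ultimately show ?thesis
    by (auto dest: tendsto_lowerbound)
qed

text \<open>Substituting \<open>z = w\<^sup>2\<close> carries the sector of opening \<open>\<pi>/4\<close> onto the quadrant and order 1 growth
  to order 2 growth.\<close>

lemma phragmen_lindelof_quadrant:
  assumes "open U" "f holomorphic_on U" and U: "{z. 0 \<le> Re z \<and> 0 \<le> Im z} \<subseteq> U"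
    and growth: "\<And>z. 0 \<le> Re z \<Longrightarrow> 0 \<le> Im z \<Longrightarrow> norm (f z) \<le> C * exp (\<beta> * norm z)"
    and edges: "\<And>z. Re z = 0 \<or> Im z = 0 \<Longrightarrow> 0 \<le> Re z \<Longrightarrow> 0 \<le> Im z \<Longrightarrow> norm (f z) \<le> K"
    and z: "0 \<le> Re z" "0 \<le> Im z"
  shows "norm (f z) \<le> K"
proof -
  have sq: "0 \<le> Re (w\<^sup>2)" "0 \<le> Im (w\<^sup>2)" if "0 \<le> Im w" "Im w \<le> Re w" for w
    using that mult_mono[of "Im w" "Re w" "Im w" "Re w"] by (auto simp: power2_eq_square)
  have root: "(csqrt z)\<^sup>2 = z" "0 \<le> Im (csqrt z)" "Im (csqrt z) \<le> Re (csqrt z)"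
    using z complex_Re_le_cmod[of z] by simp_all
  have "norm (f ((csqrt z)\<^sup>2)) \<le> K"
  proof (rule phragmen_lindelof_sector[where f = "\<lambda>w. f (w\<^sup>2)" and U = "(\<lambda>w. w\<^sup>2) -` U"])
    show "open ((\<lambda>w. w\<^sup>2) -` U)"
      using \<open>open U\<close> by (intro open_vimage continuous_intros)
    show "(\<lambda>w. f (w\<^sup>2)) holomorphic_on ((\<lambda>w. w\<^sup>2) -` U)"
      by (rule holomorphic_on_compose_gen[OF _ \<open>f holomorphic_on U\<close>, unfolded o_def])
        (auto intro!: holomorphic_intros)
    show "{w. 0 \<le> Im w \<and> Im w \<le> Re w} \<subseteq> (\<lambda>w. w\<^sup>2) -` U"
      using U sq by blast
    show "norm (f (w\<^sup>2)) \<le> C * exp (\<beta> * norm w ^ 2)" if "0 \<le> Im w" "Im w \<le> Re w" for w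
      using growth[OF sq[OF that]] by (simp add: norm_power)
    show "norm (f (w\<^sup>2)) \<le> K" if "Im w = 0" "0 \<le> Re w" for w
      using that sq[of w] by (intro edges) (auto simp: power2_eq_square)
    show "norm (f (w\<^sup>2)) \<le> K" if "Im w = Re w" "0 \<le> Re w" for w
      using that sq[of w] by (intro edges) (auto simp: power2_eq_square)
  qed (fact root)+
  then show ?thesis by (simp add: root)
qed

text \<open>For \<open>\<epsilon> > 0\<close> the only zero of \<open>1 - \<i>\<epsilon>z\<close> is \<open>- \<i>/\<epsilon>\<close>, in the lower half-plane; on the real line its modulus is
  \<open>\<surd>(1 + \<epsilon>\<^sup>2x\<^sup>2)\<close>. This makes it the right factor both for a vanishing perturbation and for a weight.\<close>

lemma norm_one_minus_imult_ge:
  assumes "0 \<le> \<epsilon>" "0 \<le> Im z"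
  shows "1 \<le> norm (1 - \<i> * of_real \<epsilon> * z)" "\<epsilon> * norm z \<le> norm (1 - \<i> * of_real \<epsilon> * z)"
proof -
  have "norm (1 - \<i> * of_real \<epsilon> * z) ^ 2 = 1 + 2 * (\<epsilon> * Im z) + (\<epsilon> * norm z) ^ 2"
    unfolding power_mult_distrib cmod_power2 by (simp add: power2_eq_square algebra_simps)
  moreover have "0 \<le> \<epsilon> * Im z" using assms by simp
  ultimately have "1 ^ 2 \<le> norm (1 - \<i> * of_real \<epsilon> * z) ^ 2"
      "(\<epsilon> * norm z) ^ 2 \<le> norm (1 - \<i> * of_real \<epsilon> * z) ^ 2"
    using zero_le_power2[of "\<epsilon> * norm z"] by (simp_all del: zero_le_power2)
  then show "1 \<le> norm (1 - \<i> * of_real \<epsilon> * z)" "\<epsilon> * norm z \<le> norm (1 - \<i> * of_real \<epsilon> * z)"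
    by (auto intro: power2_le_imp_le)
qed

text \<open>Once \<open>f\<close> is known to be bounded, the constant \<open>K\<close> improves to the bound on the line: dividing
  by \<open>1 - \<i>\<eta>z\<close> makes the function small on large half-circles, and then \<open>\<eta> \<rightarrow> 0\<close>. That \<open>M\<close> alone survives is
  essential later, since \<open>K\<close> depends on \<open>f\<close> in an uncontrolled way.\<close>

lemma bounded_half_plane_maximum:
  assumes "open U" "f holomorphic_on U" and U: "{z. 0 \<le> Im z} \<subseteq> U"
    and bounded: "\<And>z. 0 \<le> Im z \<Longrightarrow> norm (f z) \<le> K"
    and line: "\<And>z. Im z = 0 \<Longrightarrow> norm (f z) \<le> M"
    and "0 \<le> Im z0"
  shows "norm (f z0) \<le> M"
proof -
  have "0 \<le> K" "0 \<le> M"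
    using bounded[of 0] line[of 0] norm_ge_zero[of "f 0"] by (simp_all del: norm_ge_zero)
  let ?d = "\<lambda>\<eta> z. 1 - \<i> * complex_of_real \<eta> * z"
  have *: "norm (f z0) \<le> (M + \<eta>) * norm (?d \<eta> z0)" if "\<eta> > 0" for \<eta>
  proof -
    obtain R where R: "R \<ge> norm z0" "R > 0" "R \<ge> K / (\<eta> * \<eta>)"
      by (meson gt_ex less_max_iff_disj max.cobounded1 max.cobounded2 order_trans less_imp_le)
    let ?S = "cball 0 R \<inter> {z. 0 \<le> Im z}"
    let ?W = "ball 0 R \<inter> {z. 0 < Im z}"
    let ?U = "U \<inter> {z. ?d \<eta> z \<noteq> 0}"
    have "norm (f z0 / ?d \<eta> z0) \<le> M + \<eta>"
    proof (rule maximum_modulus_open_part[of ?S ?W ?U "\<lambda>z. f z / ?d \<eta> z" _ z0])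
      show "closed ?S"
        by (intro closed_Int closed_cball closed_Collect_le continuous_intros)
      show "open ?W"
        by (intro open_Int open_ball open_Collect_less continuous_intros)
      show "open ?U"
        using \<open>open U\<close> by (intro open_Int open_Collect_neq continuous_intros)
      show "?S \<subseteq> ?U"
        using U norm_one_minus_imult_ge(1)[of \<eta>] that by fastforce
      show "(\<lambda>z. f z / ?d \<eta> z) holomorphic_on ?U"
        by (intro holomorphic_intros holomorphic_on_subset[OF \<open>f holomorphic_on U\<close>]) auto
      show "norm (f z / ?d \<eta> z) \<le> M + \<eta>" if z: "z \<in> ?S - ?W" for z
      proof -
        have d: "1 \<le> norm (?d \<eta> z)" "\<eta> * norm z \<le> norm (?d \<eta> z)"
          using norm_one_minus_imult_ge[of \<eta> z] z \<open>\<eta> > 0\<close> by auto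
        consider "norm z = R" | "Im z = 0"
          using z by (auto simp: not_less)
        then show ?thesis
        proof cases
          case 1
          have "norm (f z / ?d \<eta> z) \<le> K / (\<eta> * R)"
            unfolding norm_divide using bounded[of z] z d 1 R \<open>\<eta> > 0\<close> \<open>0 \<le> K\<close>
            by (intro frac_le) auto
          also have "\<dots> \<le> \<eta>"
            using R \<open>\<eta> > 0\<close> by (simp add: field_simps)
          finally show ?thesis using \<open>0 \<le> M\<close> by simp
        next
          case 2
          have "norm (f z / ?d \<eta> z) \<le> M / 1"
            unfolding norm_divide using line[of z] d 2 \<open>0 \<le> M\<close> by (intro frac_le) auto
          then show ?thesis using \<open>\<eta> > 0\<close> by simp
        qed
      qed
      show "bounded ?S"
        by (intro bounded_Int disjI1 bounded_cball)
      show "?W \<subseteq> ?S" by auto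
      show "z0 \<in> ?S" using R \<open>0 \<le> Im z0\<close> by simp
    qed
    moreover have "norm (?d \<eta> z0) > 0"
      using norm_one_minus_imult_ge(1)[of \<eta> z0] that assms by linarith
    ultimately show ?thesis
      by (simp add: norm_divide field_simps)
  qed
  have "((\<lambda>\<eta>. (M + \<eta>) * norm (?d \<eta> z0)) \<longlongrightarrow> (M + 0) * norm (?d 0 z0)) (at_right 0)"
    by (intro tendsto_intros)
  moreover have "\<forall>\<^sub>F \<eta> in at_right 0. norm (f z0) \<le> (M + \<eta>) * norm (?d \<eta> z0)"
    using * by (auto intro: eventually_at_rightI[of 0 1])
  ultimately show ?thesis
    by (auto dest: tendsto_lowerbound)
qed

text \<open>The quotient \<open>G z = F z * exp (\<i>\<sigma>z) / (1 - \<i>\<epsilon>z)\<^sup>2\<close> is bounded by \<open>M\<close> on the real line and by \<open>C\<close> on the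
  positive imaginary axis, where the exponential exactly absorbs the growth of \<open>F\<close>. The principle in
  the two quadrants gives a bound by \<open>max M C\<close>, and the half-plane principle reduces it to \<open>M\<close>.\<close>

lemma phragmen_lindelof_weighted_upper:
  assumes hol: "F holomorphic_on UNIV" and "0 \<le> \<epsilon>"
    and growth: "\<And>z. norm (F z) \<le> C * exp (\<sigma> * norm z)"
    and line: "\<And>x::real. norm (F (of_real x)) \<le> M * (1 + (\<epsilon> * x)\<^sup>2)"
    and "0 \<le> Im z"
  shows "norm (F z) \<le> M * norm (1 - \<i> * of_real \<epsilon> * z) ^ 2 * exp (\<sigma> * Im z)"
proof -
  let ?d = "\<lambda>z. 1 - \<i> * complex_of_real \<epsilon> * z"
  define U where "U = {z. ?d z \<noteq> 0}"
  define G where "G = (\<lambda>z. F z * exp (\<i> * of_real \<sigma> * z) / ?d z ^ 2)"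
  have "open U"
    unfolding U_def by (intro open_Collect_neq continuous_intros)
  have G_hol: "G holomorphic_on U"
    unfolding G_def
    by (intro holomorphic_intros holomorphic_on_subset[OF hol]) (auto simp: U_def)
  have d1: "1 \<le> norm (?d z)" if "0 \<le> Im z" for z
    using norm_one_minus_imult_ge(1)[OF \<open>0 \<le> \<epsilon>\<close> that] .
  have U: "{z. 0 \<le> Im z} \<subseteq> U"
    using d1 by (fastforce simp: U_def)
  have norm_G: "norm (G z) = norm (F z) * exp (- (\<sigma> * Im z)) / norm (?d z) ^ 2" for z
    by (simp add: G_def norm_mult norm_divide norm_power)
  have "0 \<le> C"
    using growth[of 0] norm_ge_zero[of "F 0"] by (simp del: norm_ge_zero)
  have G_le: "norm (G z) \<le> C * exp (\<sigma> * norm z) * exp (- (\<sigma> * Im z))" if "0 \<le> Im z" for z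
  proof -
    have "norm (G z) \<le> (C * exp (\<sigma> * norm z)) * exp (- (\<sigma> * Im z)) / 1"
      unfolding norm_G using growth[of z] d1[OF that] \<open>0 \<le> C\<close>
      by (intro frac_le mult_right_mono) auto
    then show ?thesis by simp
  qed
  have G_growth: "norm (G z) \<le> C * exp (2 * \<bar>\<sigma>\<bar> * norm z)" if "0 \<le> Im z" for z
  proof -
    have "\<sigma> * norm z - \<sigma> * Im z \<le> \<bar>\<sigma>\<bar> * norm z + \<bar>\<sigma>\<bar> * norm z"
      using abs_Im_le_cmod[of z] abs_ge_self[of "\<sigma> * norm z"] abs_ge_minus_self[of "\<sigma> * Im z"]
        mult_left_mono[of "\<bar>Im z\<bar>" "norm z" "\<bar>\<sigma>\<bar>"] by (simp add: abs_mult)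
    then have "C * exp (\<sigma> * norm z - \<sigma> * Im z) \<le> C * exp (2 * \<bar>\<sigma>\<bar> * norm z)"
      using \<open>0 \<le> C\<close> by (intro mult_left_mono) auto
    moreover have "exp (\<sigma> * norm z - \<sigma> * Im z) = exp (\<sigma> * norm z) * exp (- (\<sigma> * Im z))"
      by (simp add: exp_diff exp_minus divide_inverse)
    ultimately show ?thesis
      using G_le[OF that] by (simp add: mult.assoc)
  qed
  have G_line: "norm (G z) \<le> M" if "Im z = 0" for z
  proof -
    have z: "z = of_real (Re z)"
      using that by (simp add: complex_eq_iff)
    have "norm (?d z) ^ 2 = 1 + (\<epsilon> * Re z)\<^sup>2"
      using that unfolding cmod_power2 by simp
    moreover have "1 + (\<epsilon> * Re z)\<^sup>2 > 0"
      by (simp add: add_pos_nonneg)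
    ultimately show ?thesis
      using line[of "Re z"] that z unfolding norm_G by (simp add: field_simps)
  qed
  have G_imag: "norm (G z) \<le> C" if "Re z = 0" "0 \<le> Im z" for z
  proof -
    have "norm z = Im z" using that by (simp add: cmod_def)
    then show ?thesis using G_le[OF that(2)] by (simp add: exp_minus field_simps)
  qed
  define K where "K = max M C"
  have "norm (G z) \<le> K" if "0 \<le> Im z" for z
  proof (cases "0 \<le> Re z")
    case True
    show ?thesis
    proof (rule phragmen_lindelof_quadrant[OF \<open>open U\<close> G_hol])
      show "{z. 0 \<le> Re z \<and> 0 \<le> Im z} \<subseteq> U"
        using U by blast
      show "norm (G w) \<le> C * exp (2 * \<bar>\<sigma>\<bar> * norm w)" if "0 \<le> Im w" for w
        by (rule G_growth[OF that])
      show "norm (G w) \<le> K" if "Re w = 0 \<or> Im w = 0" "0 \<le> Re w" "0 \<le> Im w" for w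
        using that G_line[of w] G_imag[of w] unfolding K_def le_max_iff_disj by blast
    qed (fact True that)+
  next
    case False
    \<comment> \<open>A quarter turn carries the second quadrant to the first.\<close>
    have "norm (G (\<i> * (- \<i> * z))) \<le> K"
    proof (rule phragmen_lindelof_quadrant[where f = "\<lambda>w. G (\<i> * w)" and U = "(\<lambda>w. \<i> * w) -` U"
            and C = C and \<beta> = "2 * \<bar>\<sigma>\<bar>"])
      show "open ((\<lambda>w. \<i> * w) -` U)"
        using \<open>open U\<close> by (intro open_vimage continuous_intros)
      show "(\<lambda>w. G (\<i> * w)) holomorphic_on (\<lambda>w. \<i> * w) -` U"
        by (rule holomorphic_on_compose_gen[OF _ G_hol, unfolded o_def])
          (auto intro!: holomorphic_intros)
      show "norm (G (\<i> * w)) \<le> C * exp (2 * \<bar>\<sigma>\<bar> * norm w)" if "0 \<le> Re w" "0 \<le> Im w" for w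
        using G_growth[of "\<i> * w"] that by (simp add: norm_mult)
      show "norm (G (\<i> * w)) \<le> K"
        if "Re w = 0 \<or> Im w = 0" "0 \<le> Re w" "0 \<le> Im w" for w
        using that G_line[of "\<i> * w"] G_imag[of "\<i> * w"] unfolding K_def le_max_iff_disj by auto
      show "{w. 0 \<le> Re w \<and> 0 \<le> Im w} \<subseteq> (\<lambda>w. \<i> * w) -` U"
        using U by (auto simp: subset_iff)
      show "0 \<le> Re (- \<i> * z)" "0 \<le> Im (- \<i> * z)"
        using False that by auto
    qed
    then show ?thesis by simp
  qed
  then have "norm (G z) \<le> M"
    using bounded_half_plane_maximum[OF \<open>open U\<close> G_hol U _ G_line \<open>0 \<le> Im z\<close>] by blast
  moreover have "norm (?d z) ^ 2 > 0"
    using d1[OF \<open>0 \<le> Im z\<close>] by (intro zero_less_power) linarith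
  ultimately show ?thesis
    unfolding norm_G by (simp add: exp_minus field_simps)
qed

text \<open>The reflection \<open>z \<mapsto> - z\<close> covers the lower half-plane. The triangle inequality moves the weight
  from \<open>z\<close> to a real base point \<open>x\<close>, so that near \<open>x\<close> the bound is comparable with
  the weight \<open>1 + \<epsilon>\<^sup>2x\<^sup>2\<close> at \<open>x\<close>.\<close>

lemma phragmen_lindelof_weighted:
  assumes hol: "F holomorphic_on UNIV" and "0 \<le> \<epsilon>"
    and growth: "\<And>z. norm (F z) \<le> C * exp (\<sigma> * norm z)"
    and line: "\<And>x::real. norm (F (of_real x)) \<le> M * (1 + (\<epsilon> * x)\<^sup>2)"
  shows "norm (F z) \<le> M * (norm (1 - \<i> * of_real \<epsilon> * of_real x) + \<epsilon> * norm (z - of_real x)) ^ 2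
           * exp (\<sigma> * \<bar>Im z\<bar>)"
proof -
  have "0 \<le> M"
    using line[of 0] norm_ge_zero[of "F 0"] by (simp del: norm_ge_zero)
  have up: "norm (G w) \<le> M * (norm (1 - \<i> * of_real \<epsilon> * of_real y) + \<epsilon> * norm (w - of_real y)) ^ 2
           * exp (\<sigma> * Im w)"
    if "G holomorphic_on UNIV" "\<And>z. norm (G z) \<le> C * exp (\<sigma> * norm z)"
      "\<And>x::real. norm (G (of_real x)) \<le> M * (1 + (\<epsilon> * x)\<^sup>2)" "0 \<le> Im w" for G w and y :: real
  proof -
    have "1 - \<i> * of_real \<epsilon> * w = (1 - \<i> * of_real \<epsilon> * of_real y) - \<i> * of_real \<epsilon> * (w - of_real y)"
      by (simp add: algebra_simps)
    then have "norm (1 - \<i> * of_real \<epsilon> * w)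
        \<le> norm (1 - \<i> * of_real \<epsilon> * of_real y) + \<epsilon> * norm (w - of_real y)"
      using norm_triangle_ineq4[of "1 - \<i> * of_real \<epsilon> * of_real y" "\<i> * of_real \<epsilon> * (w - of_real y)"]
        \<open>0 \<le> \<epsilon>\<close> by (simp only: norm_mult norm_ii norm_of_real mult_1 abs_of_nonneg)
    then have "M * norm (1 - \<i> * of_real \<epsilon> * w) ^ 2 * exp (\<sigma> * Im w)
        \<le> M * (norm (1 - \<i> * of_real \<epsilon> * of_real y) + \<epsilon> * norm (w - of_real y)) ^ 2 * exp (\<sigma> * Im w)"
      using \<open>0 \<le> M\<close> by (intro mult_right_mono mult_left_mono power_mono) auto
    then show ?thesis
      using phragmen_lindelof_weighted_upper[OF that(1) \<open>0 \<le> \<epsilon>\<close> that(2,3,4)] by linarith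
  qed
  show ?thesis
  proof (cases "0 \<le> Im z")
    case True
    then show ?thesis using up[OF hol growth line True, of x] by simp
  next
    case False
    have "(\<lambda>z. F (- z)) holomorphic_on UNIV"
      using holomorphic_on_compose_gen[of uminus UNIV F UNIV] hol
      by (simp add: o_def holomorphic_on_minus)
    then have "norm (F (- (- z))) \<le> M * (norm (1 - \<i> * of_real \<epsilon> * of_real (- x))
        + \<epsilon> * norm (- z - of_real (- x))) ^ 2 * exp (\<sigma> * Im (- z))"
    proof (rule up)
      show "norm (F (- w)) \<le> C * exp (\<sigma> * norm w)" for w
        using growth[of "- w"] by simp
      show "norm (F (- of_real y)) \<le> M * (1 + (\<epsilon> * y)\<^sup>2)" for y :: real
        using line[of "- y"] by simp
    qed (use False in simp)
    moreover have "norm (1 - \<i> * of_real \<epsilon> * of_real (- x)) = norm (1 - \<i> * of_real \<epsilon> * of_real x)"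
      by (simp add: cmod_def)
    moreover have "norm (- z - of_real (- x)) = norm (z - of_real x)"
      by (simp add: norm_minus_commute)
    ultimately show ?thesis
      using False by simp
  qed
qed

section \<open>Functions on the line with bounded second differences\<close>

text \<open>First differences with step \<open>h\<close> grow by at most \<open>B\<close> from one step to the next, so they grow linearly and
  the values grow quadratically.\<close>

lemma quadratic_growth_half_line:
  fixes P :: "real \<Rightarrow> complex"
  assumes cont: "continuous_on UNIV P" and "h > 0"
    and diff2: "\<And>x. norm (P (x + 2 * h) - 2 * P (x + h) + P x) \<le> B"
  shows "\<exists>D\<ge>0. \<forall>x\<ge>0. norm (P x) \<le> D * (1 + x\<^sup>2)"
proof -
  have "compact (P ` {0..2 * h})"
    by (intro compact_continuous_image continuous_on_subset[OF cont]) auto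
  then obtain A where "A > 0" and A: "\<And>x. 0 \<le> x \<Longrightarrow> x \<le> 2 * h \<Longrightarrow> norm (P x) \<le> A"
    by (auto dest!: compact_imp_bounded simp: bounded_pos)
  have "0 \<le> B"
    using diff2[of 0] order_trans[OF norm_ge_zero] by blast
  have bound: "norm (P (y + (real n + 1) * h) - P (y + real n * h)) \<le> 2 * A + real n * B \<and>
      norm (P (y + real n * h)) \<le> A + real n * (2 * A) + (real n)\<^sup>2 * B"
    if "0 \<le> y" "y \<le> h" for y n
  proof (induction n)
    case 0
    show ?case
      using A[of y] A[of "y + h"] that \<open>h > 0\<close> norm_triangle_ineq4[of "P (y + h)" "P y"] by simp
  next
    case (Suc n)
    let ?x = "y + real n * h"
    have x: "y + (real n + 1) * h = ?x + h" "y + (real (Suc n) + 1) * h = ?x + 2 * h"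
      "y + real (Suc n) * h = ?x + h"
      by (simp_all add: algebra_simps)
    have "norm (P (?x + 2 * h) - P (?x + h)) \<le> norm (P (?x + h) - P ?x) + B"
      using diff2[of ?x] norm_triangle_ineq[of "P (?x + h) - P ?x" "P (?x + 2 * h) - 2 * P (?x + h) + P ?x"]
      by (simp add: algebra_simps)
    moreover have "norm (P (?x + h)) \<le> norm (P ?x) + norm (P (?x + h) - P ?x)"
      using norm_triangle_ineq[of "P ?x" "P (?x + h) - P ?x"] by simp
    moreover have "(real (Suc n))\<^sup>2 * B = (real n)\<^sup>2 * B + 2 * (real n * B) + B"
      by (simp add: power2_eq_square algebra_simps)
    moreover have "0 \<le> real n * B"
      using \<open>0 \<le> B\<close> by simp
    moreover have "real (Suc n) * (2 * A) = real n * (2 * A) + 2 * A" "real (Suc n) * B = real n * B + B"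
      by (simp_all add: algebra_simps)
    ultimately show ?case
      using Suc \<open>0 \<le> B\<close> unfolding x by linarith
  qed
  define D where "D = 2 * A + (A + B) / h\<^sup>2"
  have "norm (P x) \<le> D * (1 + x\<^sup>2)" if "x \<ge> 0" for x
  proof -
    define n where "n = nat \<lfloor>x / h\<rfloor>"
    have n: "real n \<le> x / h" "x / h < real n + 1"
      unfolding n_def using that \<open>h > 0\<close> by auto
    then have y: "0 \<le> x - real n * h" "x - real n * h \<le> h"
      using \<open>h > 0\<close> by (simp_all add: field_simps)
    have "norm (P x) \<le> A + real n * (2 * A) + (real n)\<^sup>2 * B"
      using bound[OF y, of n] by simp
    also have "\<dots> \<le> 2 * A + (A + B) * (real n)\<^sup>2"
    proof -
      have "0 \<le> A * (real n - 1)\<^sup>2"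
        using \<open>A > 0\<close> by simp
      then show ?thesis
        unfolding power2_diff by (simp add: algebra_simps)
    qed
    also have "\<dots> \<le> 2 * A + (A + B) * (x / h)\<^sup>2"
      using n(1) \<open>A > 0\<close> \<open>0 \<le> B\<close> by (intro add_left_mono mult_left_mono power_mono) auto
    also have "\<dots> = 2 * A + (A + B) / h\<^sup>2 * x\<^sup>2"
      by (simp add: power_divide)
    also have "\<dots> \<le> D + D * x\<^sup>2"
      unfolding D_def using \<open>A > 0\<close> \<open>0 \<le> B\<close> by (intro add_mono mult_right_mono) auto
    finally show ?thesis by (simp add: algebra_simps)
  qed
  moreover have "D \<ge> 0"
    using \<open>A > 0\<close> \<open>0 \<le> B\<close> by (simp add: D_def)
  ultimately show ?thesis by blast
qed

lemma quadratic_growth: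
  fixes P :: "real \<Rightarrow> complex"
  assumes cont: "continuous_on UNIV P" and "h > 0"
    and diff2: "\<And>x. norm (P (x + 2 * h) - 2 * P (x + h) + P x) \<le> B"
  shows "\<exists>D\<ge>0. \<forall>x. norm (P x) \<le> D * (1 + x\<^sup>2)"
proof -
  obtain D1 where D1: "D1 \<ge> 0" "\<And>x. x \<ge> 0 \<Longrightarrow> norm (P x) \<le> D1 * (1 + x\<^sup>2)"
    using quadratic_growth_half_line[OF assms] by blast
  have "continuous_on UNIV (\<lambda>x. P (- x))"
    by (rule continuous_on_compose2[OF cont]) (auto intro: continuous_intros)
  moreover have "norm (P (- (x + 2 * h)) - 2 * P (- (x + h)) + P (- x)) \<le> B" for x
    using diff2[of "- x - 2 * h"] by (simp add: algebra_simps)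
  ultimately obtain D2 where D2: "D2 \<ge> 0" "\<And>x. x \<ge> 0 \<Longrightarrow> norm (P (- x)) \<le> D2 * (1 + x\<^sup>2)"
    using quadratic_growth_half_line[of "\<lambda>x. P (- x)", OF _ \<open>h > 0\<close>] by blast
  have "norm (P x) \<le> (D1 + D2) * (1 + x\<^sup>2)" for x
  proof (cases "x \<ge> 0")
    case True
    have "0 \<le> D2 * (1 + x\<^sup>2)" using D2(1) by simp
    then show ?thesis using D1(2)[OF True] by (simp add: algebra_simps)
  next
    case False
    have "0 \<le> D1 * (1 + x\<^sup>2)" using D1(1) by simp
    then show ?thesis using D2(2)[of "- x"] False by (simp add: algebra_simps)
  qed
  then show ?thesis using D1(1) D2(1) by (intro exI[of _ "D1 + D2"]) auto
qed

section \<open>A Bernstein type inequality from second differences\<close>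

lemma Cauchy_inequality_entire:
  assumes "f holomorphic_on UNIV" "0 < r" "\<And>w. norm (w - z) = r \<Longrightarrow> norm (f w) \<le> B"
  shows "norm ((deriv ^^ n) f z) \<le> fact n * B / r ^ n"
  using assms
  by (intro Cauchy_inequality)
    (auto simp: norm_minus_commute intro: holomorphic_on_subset continuous_on_subset
      holomorphic_on_imp_continuous_on)

lemma exp_growth_higher_deriv:
  assumes "f holomorphic_on UNIV" "0 \<le> \<sigma>" "\<And>z. norm (f z) \<le> C * exp (\<sigma> * norm z)"
  shows "norm ((deriv ^^ n) f z) \<le> fact n * C * exp \<sigma> * exp (\<sigma> * norm z)"
proof -
  have "0 \<le> C"
    using assms(3)[of 0] order_trans[OF norm_ge_zero] by fastforce
  have "norm (f w) \<le> C * exp (\<sigma> + \<sigma> * norm z)" if "norm (w - z) = 1" for w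
  proof -
    have "norm w \<le> 1 + norm z"
      using norm_triangle_ineq[of "w - z" z] that by simp
    then have "\<sigma> * norm w \<le> \<sigma> * (1 + norm z)"
      using \<open>0 \<le> \<sigma>\<close> by (intro mult_left_mono) auto
    then have "C * exp (\<sigma> * norm w) \<le> C * exp (\<sigma> + \<sigma> * norm z)"
      using \<open>0 \<le> C\<close> by (intro mult_left_mono) (auto simp: algebra_simps)
    then show ?thesis using assms(3)[of w] by linarith
  qed
  from Cauchy_inequality_entire[where n = n and z = z, OF assms(1) zero_less_one this]
  show ?thesis by (simp add: exp_add algebra_simps)
qed

text \<open>In the second difference of the Taylor polynomial of degree 2 at \<open>x\<close> only \<open>h\<^sup>2 P''(x)\<close> survives. The
  remainders at \<open>x + 2h\<close> and \<open>x + h\<close> contribute \<open>(2h)\<^sup>3 T / 2\<close> and \<open>2 \<cdot> h\<^sup>3 T / 2\<close>, together \<open>5 h\<^sup>3 T\<close>.\<close>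

lemma Taylor_second_difference:
  assumes hol: "P holomorphic_on UNIV" and "h > 0"
    and third: "\<And>t. t \<in> {x..x + 2 * h} \<Longrightarrow> norm ((deriv ^^ 3) P (of_real t)) \<le> T"
    and diff2: "norm (P (of_real (x + 2 * h)) - 2 * P (of_real (x + h)) + P (of_real x)) \<le> B"
  shows "h\<^sup>2 * norm ((deriv ^^ 2) P (of_real x)) \<le> B + 5 * h ^ 3 * T"
proof -
  let ?S = "closed_segment (complex_of_real x) (of_real (x + 2 * h))"
  have S: "?S = of_real ` {x..x + 2 * h}"
    using \<open>h > 0\<close> by (simp only: closed_segment_of_real closed_segment_eq_real_ivl) auto
  define R where "R = (\<lambda>s. P (of_real (x + s)) - (P (of_real x) + deriv P (of_real x) * of_real s
      + (deriv ^^ 2) P (of_real x) * (of_real s)\<^sup>2 / 2))"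
  have R: "norm (R s) \<le> T * s ^ 3 / 2" if "0 \<le> s" "s \<le> 2 * h" for s
  proof -
    have "norm ((deriv ^^ 0) P (of_real (x + s))
        - (\<Sum>i\<le>2. (deriv ^^ i) P (of_real x) * (of_real (x + s) - of_real x) ^ i / fact i))
        \<le> T * norm (of_real (x + s) - complex_of_real x) ^ Suc 2 / fact 2"
    proof (rule complex_Taylor[of ?S 2 "\<lambda>i. (deriv ^^ i) P"])
      show "((deriv ^^ i) P has_field_derivative (deriv ^^ Suc i) P z) (at z within ?S)" for i z
        using holomorphic_derivI[OF holomorphic_higher_deriv[OF hol open_UNIV] open_UNIV] by simp
      show "norm ((deriv ^^ Suc 2) P z) \<le> T" if "z \<in> ?S" for z
      proof -
        obtain t where "t \<in> {x..x + 2 * h}" "z = of_real t"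
          using \<open>z \<in> ?S\<close> unfolding S by blast
        then show ?thesis
          using third[of t] by (simp add: numeral_3_eq_3 numeral_2_eq_2)
      qed
      show "complex_of_real x \<in> ?S" "complex_of_real (x + s) \<in> ?S"
        using that \<open>h > 0\<close> unfolding S by (auto intro!: imageI simp del: of_real_add)
    qed simp
    moreover have "(\<Sum>i\<le>2. (deriv ^^ i) P (of_real x) * (of_real (x + s) - of_real x) ^ i / fact i)
       = P (of_real x) + deriv P (of_real x) * of_real s + (deriv ^^ 2) P (of_real x) * (of_real s)\<^sup>2 / 2"
      by (simp add: numeral_2_eq_2)
    moreover have "norm (of_real (x + s) - complex_of_real x) ^ Suc 2 = s ^ 3"
      using that by (simp add: numeral_3_eq_3 numeral_2_eq_2)
    ultimately show ?thesis
      by (simp add: R_def)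
  qed
  let ?\<Delta> = "P (of_real (x + 2 * h)) - 2 * P (of_real (x + h)) + P (of_real x)"
  have "(of_real h)\<^sup>2 * (deriv ^^ 2) P (of_real x) = ?\<Delta> - R (2 * h) + 2 * R h"
    by (simp add: R_def power2_eq_square field_simps)
  then have "h\<^sup>2 * norm ((deriv ^^ 2) P (of_real x)) = norm (?\<Delta> - R (2 * h) + 2 * R h)"
    by (metis norm_mult norm_power norm_of_real power2_abs)
  also have "\<dots> \<le> norm ?\<Delta> + norm (R (2 * h)) + 2 * norm (R h)"
    using norm_triangle_ineq[of "?\<Delta> - R (2 * h)" "2 * R h"] norm_triangle_ineq4[of ?\<Delta> "R (2 * h)"]
    by (simp add: norm_mult)
  also have "\<dots> \<le> B + T * (2 * h) ^ 3 / 2 + 2 * (T * h ^ 3 / 2)"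
    using diff2 R[of h] R[of "2 * h"] \<open>h > 0\<close> by simp
  also have "\<dots> = B + 5 * h ^ 3 * T"
    by (simp add: power3_eq_cube)
  finally show ?thesis .
qed

lemma norm_one_minus_imult_real:
  "norm (1 - \<i> * of_real \<epsilon> * complex_of_real x) ^ 2 = 1 + (\<epsilon> * x)\<^sup>2"
  by (simp add: cmod_power2)

text \<open>This is the Cauchy estimate on a circle of radius \<open>1/\<sigma>\<close>. On it, \<open>exp (\<sigma>\<bar>Im w\<bar>) \<le> e \<le> 3\<close>, and since
  the circle lies within distance 2 of \<open>x\<close> the weight there is at most \<open>3\<^sup>2\<close> times its value
  at \<open>x\<close>; hence \<open>27 = 9 \<cdot> 3\<close>. The constant is uniform in \<open>\<epsilon>\<close>.\<close>

lemma weighted_Bernstein: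
  assumes hol: "g holomorphic_on UNIV" and "\<sigma> \<ge> 1" "0 \<le> \<epsilon>" "\<epsilon> \<le> 1"
    and growth: "\<And>z. norm (g z) \<le> C * exp (\<sigma> * norm z)"
    and line: "\<And>x::real. norm (g (of_real x)) \<le> M * (1 + (\<epsilon> * x)\<^sup>2)"
    and "\<bar>t - x\<bar> \<le> 1"
  shows "norm (deriv g (of_real t)) \<le> 27 * \<sigma> * M * (1 + (\<epsilon> * x)\<^sup>2)"
proof -
  let ?n = "norm (1 - \<i> * of_real \<epsilon> * complex_of_real x)"
  have "0 \<le> M"
    using line[of 0] order_trans[OF norm_ge_zero] by fastforce
  have "?n \<ge> 1"
    using norm_one_minus_imult_ge(1)[of \<epsilon> "of_real x"] \<open>0 \<le> \<epsilon>\<close> by simp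
  have "norm (g w) \<le> 27 * M * (1 + (\<epsilon> * x)\<^sup>2)" if w: "norm (w - of_real t) = 1 / \<sigma>" for w
  proof -
    have "norm (complex_of_real t - of_real x) = \<bar>t - x\<bar>"
      by (metis norm_of_real of_real_diff)
    then have "norm (w - of_real x) \<le> 1 / \<sigma> + \<bar>t - x\<bar>"
      using norm_triangle_ineq[of "w - of_real t" "of_real t - of_real x"] w by simp
    also have "\<dots> \<le> 1 + 1"
      using \<open>\<sigma> \<ge> 1\<close> \<open>\<bar>t - x\<bar> \<le> 1\<close> by (intro add_mono) auto
    finally have "\<epsilon> * norm (w - of_real x) \<le> 1 * 2"
      using \<open>0 \<le> \<epsilon>\<close> \<open>\<epsilon> \<le> 1\<close> by (intro mult_mono) auto
    then have "?n + \<epsilon> * norm (w - of_real x) \<le> 3 * ?n"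
      using \<open>?n \<ge> 1\<close> by simp
    then have "(?n + \<epsilon> * norm (w - of_real x)) ^ 2 \<le> (3 * ?n) ^ 2"
      using \<open>0 \<le> \<epsilon>\<close> by (intro power_mono) auto
    then have n: "(?n + \<epsilon> * norm (w - of_real x)) ^ 2 \<le> 9 * (1 + (\<epsilon> * x)\<^sup>2)"
      unfolding power_mult_distrib norm_one_minus_imult_real by simp
    have "\<bar>Im w\<bar> \<le> 1 / \<sigma>"
      using abs_Im_le_cmod[of "w - of_real t"] w by simp
    then have "\<sigma> * \<bar>Im w\<bar> \<le> 1"
      using \<open>\<sigma> \<ge> 1\<close> by (simp add: field_simps)
    then have e: "exp (\<sigma> * \<bar>Im w\<bar>) \<le> 3"
      using exp_le by (metis exp_le_cancel_iff order_trans)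
    have "norm (g w) \<le> M * (?n + \<epsilon> * norm (w - of_real x)) ^ 2 * exp (\<sigma> * \<bar>Im w\<bar>)"
      by (rule phragmen_lindelof_weighted[OF hol \<open>0 \<le> \<epsilon>\<close> growth line])
    also have "\<dots> \<le> (M * (9 * (1 + (\<epsilon> * x)\<^sup>2))) * 3"
      using n e \<open>0 \<le> M\<close> by (intro mult_mono mult_left_mono) auto
    finally show ?thesis by (simp add: algebra_simps)
  qed
  from Cauchy_inequality_entire[where n = 1 and z = "of_real t" and r = "1 / \<sigma>", OF hol _ this]
  show ?thesis using \<open>\<sigma> \<ge> 1\<close> by (simp add: field_simps)
qed

text \<open>A qualitative estimate, from the Cauchy estimate on the unit circle about \<open>x\<close>. It serves to make the
  weighted suprema of \<open>\<bar>P''\<bar>\<close> finite, so the size of its constant is immaterial.\<close>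

lemma second_derivative_growth:
  assumes hol: "P holomorphic_on UNIV" and "\<sigma> \<ge> 0"
    and growth: "\<And>z. norm (P z) \<le> C * exp (\<sigma> * norm z)"
    and line: "\<And>x::real. norm (P (of_real x)) \<le> D * (1 + x\<^sup>2)"
  shows "norm ((deriv ^^ 2) P (of_real x)) \<le> 8 * D * exp \<sigma> * (1 + x\<^sup>2)"
proof -
  let ?n = "norm (1 - \<i> * of_real 1 * complex_of_real x)"
  have "0 \<le> D"
    using line[of 0] order_trans[OF norm_ge_zero] by fastforce
  have "?n \<ge> 1"
    using norm_one_minus_imult_ge(1)[of 1 "of_real x"] by simp
  have "norm (P w) \<le> 4 * D * exp \<sigma> * (1 + x\<^sup>2)" if w: "norm (w - of_real x) = 1" for w
  proof -
    have "(?n + 1 * norm (w - of_real x)) ^ 2 \<le> (2 * ?n) ^ 2"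
      using \<open>?n \<ge> 1\<close> w by (intro power_mono) auto
    then have n: "(?n + 1 * norm (w - of_real x)) ^ 2 \<le> 4 * (1 + x\<^sup>2)"
      unfolding power_mult_distrib norm_one_minus_imult_real by simp
    have "\<bar>Im w\<bar> \<le> 1"
      using abs_Im_le_cmod[of "w - of_real x"] w by simp
    then have e: "exp (\<sigma> * \<bar>Im w\<bar>) \<le> exp \<sigma>"
      using mult_left_mono[of "\<bar>Im w\<bar>" 1 \<sigma>] \<open>\<sigma> \<ge> 0\<close> by simp
    have "norm (P w) \<le> D * (?n + 1 * norm (w - of_real x)) ^ 2 * exp (\<sigma> * \<bar>Im w\<bar>)"
      by (rule phragmen_lindelof_weighted[OF hol _ growth]) (use line in auto)
    also have "\<dots> \<le> (D * (4 * (1 + x\<^sup>2))) * exp \<sigma>"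
      using n e \<open>0 \<le> D\<close> by (intro mult_mono mult_left_mono) auto
    finally show ?thesis by (simp add: algebra_simps)
  qed
  from Cauchy_inequality_entire[where n = 2 and z = "of_real x", OF hol zero_less_one this]
  show ?thesis by simp
qed

text \<open>Put \<open>g = P''\<close> and let \<open>M\<close> be the supremum over the line of \<open>\<bar>g(x)\<bar> / (1 + \<epsilon>\<^sup>2x\<^sup>2)\<close>, which is finite because
  \<open>g\<close> grows at most quadratically. By the weighted Bernstein inequality \<open>g'\<close> is at most \<open>27 \<sigma> M\<close> times the weight, so
  Taylor's formula gives \<open>M \<le> B / h\<^sup>2 + 135 \<sigma> h M\<close>. The step \<open>h = 1 / (270 \<sigma>)\<close> makes the last term \<open>M / 2\<close>, which
  can be absorbed since \<open>M\<close> is finite. The resulting bound \<open>M \<le> 2 B / h\<^sup>2\<close> is independent of \<open>\<epsilon>\<close>, and \<open>\<epsilon>\<close> tends to 0.\<close>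

lemma second_derivative_le_second_difference:
  assumes hol: "P holomorphic_on UNIV" and "\<sigma> \<ge> 1" and h: "h = 1 / (270 * \<sigma>)"
    and growth: "\<And>z. norm (P z) \<le> C * exp (\<sigma> * norm z)"
    and diff2: "\<And>x. norm (P (of_real (x + 2 * h)) - 2 * P (of_real (x + h)) + P (of_real x)) \<le> B"
  shows "norm ((deriv ^^ 2) P (of_real x)) \<le> 2 * B / h\<^sup>2"
proof -
  define g where "g = (deriv ^^ 2) P"
  have "h > 0" and h_le: "2 * h \<le> 1"
    using \<open>\<sigma> \<ge> 1\<close> by (auto simp: h field_simps)
  have g_hol: "g holomorphic_on UNIV"
    unfolding g_def by (intro holomorphic_higher_deriv hol open_UNIV)
  have deriv_g: "deriv g = (deriv ^^ 3) P"
    by (simp add: g_def numeral_3_eq_3 numeral_2_eq_2)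
  have g_growth: "norm (g z) \<le> (fact 2 * C * exp \<sigma>) * exp (\<sigma> * norm z)" for z
    unfolding g_def using \<open>\<sigma> \<ge> 1\<close> by (intro exp_growth_higher_deriv hol growth) simp
  have "continuous_on UNIV (\<lambda>x. P (complex_of_real x))"
    by (rule continuous_on_compose2[OF holomorphic_on_imp_continuous_on[OF hol]])
      (auto intro: continuous_intros)
  from quadratic_growth[OF this \<open>h > 0\<close> diff2]
  obtain D where D: "D \<ge> 0" "\<And>x::real. norm (P (of_real x)) \<le> D * (1 + x\<^sup>2)"
    by blast
  define E where "E = 8 * D * exp \<sigma>"
  have "E \<ge> 0" using D by (simp add: E_def)
  have E: "norm (g (of_real x)) \<le> E * (1 + x\<^sup>2)" for x
    unfolding g_def E_def using \<open>\<sigma> \<ge> 1\<close> by (intro second_derivative_growth[OF hol _ growth D(2)]) simp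
  have *: "norm (g (of_real x)) \<le> 2 * B / h\<^sup>2 * (1 + (\<epsilon> * x)\<^sup>2)" if \<epsilon>: "0 < \<epsilon>" "\<epsilon> \<le> 1" for x \<epsilon>
  proof -
    let ?w = "\<lambda>x::real. 1 + (\<epsilon> * x)\<^sup>2"
    have w_pos: "?w x > 0" for x
      by (simp add: add_pos_nonneg)
    define M where "M = (SUP x. norm (g (of_real x)) / ?w x)"
    have "norm (g (of_real x)) / ?w x \<le> E / \<epsilon>\<^sup>2" for x
    proof -
      \<comment> \<open>Quadratic growth makes the weighted supremum finite; the bound may depend on \<open>\<epsilon>\<close>.\<close>
      have "\<epsilon>\<^sup>2 * (1 + x\<^sup>2) \<le> ?w x"
        using \<epsilon> by (simp add: power_mult_distrib distrib_left power_le_one)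
      then have "E * (\<epsilon>\<^sup>2 * (1 + x\<^sup>2)) \<le> E * ?w x"
        using \<open>E \<ge> 0\<close> by (intro mult_left_mono)
      then have "E * (1 + x\<^sup>2) \<le> E / \<epsilon>\<^sup>2 * ?w x"
        using \<epsilon> by (simp add: field_simps)
      then show ?thesis
        using E[of x] w_pos[of x] by (simp add: pos_divide_le_eq)
    qed
    then have bdd: "bdd_above (range (\<lambda>x. norm (g (of_real x)) / ?w x))"
      by (intro bdd_aboveI[of _ "E / \<epsilon>\<^sup>2"]) auto
    have M: "norm (g (of_real x)) \<le> M * ?w x" for x
      using cSUP_upper[OF UNIV_I bdd, of x] w_pos[of x] by (simp add: M_def pos_divide_le_eq)
    have "norm (g (of_real x)) / ?w x \<le> B / h\<^sup>2 + M / 2" for x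
    proof -
      have "B \<ge> 0"
        using diff2[of 0] order_trans[OF norm_ge_zero] by blast
      have "h\<^sup>2 * norm (g (of_real x)) \<le> B + 5 * h ^ 3 * (27 * \<sigma> * M * ?w x)"
        unfolding g_def
      proof (rule Taylor_second_difference[OF hol \<open>h > 0\<close> _ diff2])
        show "norm ((deriv ^^ 3) P (of_real t)) \<le> 27 * \<sigma> * M * ?w x" if "t \<in> {x..x + 2 * h}" for t
          unfolding deriv_g[symmetric] using that h_le \<epsilon> \<open>\<sigma> \<ge> 1\<close>
          by (intro weighted_Bernstein[OF g_hol _ _ _ g_growth M]) auto
      qed
      also have "5 * h ^ 3 * (27 * \<sigma> * M * ?w x) = h\<^sup>2 * (M / 2 * ?w x)"
        using \<open>\<sigma> \<ge> 1\<close> by (simp add: h power2_eq_square power3_eq_cube)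
      also have "B \<le> B * ?w x"
        using \<open>B \<ge> 0\<close> by (simp add: mult_le_cancel_left1)
      finally have "h\<^sup>2 * norm (g (of_real x)) \<le> B * ?w x + h\<^sup>2 * (M / 2 * ?w x)"
        by simp
      also have "\<dots> = h\<^sup>2 * ((B / h\<^sup>2 + M / 2) * ?w x)"
        using \<open>h > 0\<close> by (simp add: distrib_left distrib_right)
      finally have "h\<^sup>2 * norm (g (of_real x)) \<le> h\<^sup>2 * ((B / h\<^sup>2 + M / 2) * ?w x)" .
      then show ?thesis
        using \<open>h > 0\<close> w_pos[of x] by (simp add: pos_divide_le_eq)
    qed
    then have "M \<le> B / h\<^sup>2 + M / 2"
      unfolding M_def by (intro cSUP_least) auto
    then have "M * ?w x \<le> 2 * B / h\<^sup>2 * ?w x"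
      using w_pos[of x] by (intro mult_right_mono) auto
    then show ?thesis using M[of x] by linarith
  qed
  have "((\<lambda>\<epsilon>. 2 * B / h\<^sup>2 * (1 + (\<epsilon> * x)\<^sup>2)) \<longlongrightarrow> 2 * B / h\<^sup>2 * (1 + (0 * x)\<^sup>2)) (at_right 0)"
    by (intro tendsto_intros)
  moreover have "\<forall>\<^sub>F \<epsilon> in at_right 0. norm (g (of_real x)) \<le> 2 * B / h\<^sup>2 * (1 + (\<epsilon> * x)\<^sup>2)"
    using * by (auto intro: eventually_at_rightI[of 0 1])
  ultimately have "norm (g (of_real x)) \<le> 2 * B / h\<^sup>2 * (1 + (0 * x)\<^sup>2)"
    by (rule tendsto_lowerbound) simp
  then show ?thesis by (simp add: g_def)
qed

section \<open>Bounded mean oscillation\<close>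

lemma mean_oscillation_le_bmo_norm:
  assumes "a < b"
  shows "(\<integral>\<^sup>+t\<in>{a..b}. ennreal (norm (f t - mean_on {a..b} f)) \<partial>lborel) \<le> ennreal (b - a) * bmo_norm f"
proof -
  let ?O = "\<integral>\<^sup>+t\<in>{a..b}. ennreal (norm (f t - mean_on {a..b} f)) \<partial>lborel"
  have "?O / emeasure lborel {a..b} \<le> bmo_norm f"
    unfolding bmo_norm_def using \<open>a < b\<close> by (intro SUP_upper) auto
  then have "ennreal (b - a) * (?O / ennreal (b - a)) \<le> ennreal (b - a) * bmo_norm f"
    using \<open>a < b\<close> by (intro mult_left_mono) auto
  then show ?thesis
    using \<open>a < b\<close> by (simp add: ennreal_times_divide ennreal_mult_divide_eq mult.commute[of _ ?O])
qed

text \<open>The second difference of \<open>P\<close> is the difference of the integrals of \<open>f\<close> over the two halves of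
  \<open>[x, x + 2h]\<close>. It is unchanged if the mean of \<open>f\<close> over the whole interval is subtracted from \<open>f\<close>, and then each
  integral is at most the total oscillation of \<open>f\<close> over that interval.\<close>

lemma second_difference_primitive_le_bmo_norm:
  fixes f P :: "real \<Rightarrow> complex"
  assumes cont: "continuous_on UNIV f" and P: "\<And>t. (P has_vector_derivative f t) (at t)"
    and fin: "bmo_norm f < \<infinity>" and "h > 0"
  shows "norm (P (x + 2 * h) - 2 * P (x + h) + P x) \<le> 4 * h * enn2real (bmo_norm f)"
proof -
  define N where "N = enn2real (bmo_norm f)"
  have N: "bmo_norm f = ennreal N" "N \<ge> 0"
    using fin by (simp_all add: N_def)
  let ?K = "{x..x + 2 * h}"
  define m where "m = mean_on ?K f"
  define Q where "Q = (\<lambda>t. P t - of_real t * m)"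
  have Q: "norm (Q b - Q a) \<le> 2 * h * N" if ab: "x \<le> a" "a \<le> b" "b \<le> x + 2 * h" for a b
  proof -
    let ?I = "\<lambda>t. indicator {a..b} t *\<^sub>R (f t - m)"
    have cont': "continuous_on {a..b} (\<lambda>t. f t - m)"
      by (intro continuous_intros continuous_on_subset[OF cont]) auto
    have "integral\<^sup>L lborel ?I = Q b - Q a"
    proof (rule integral_FTC_atLeastAtMost[OF \<open>a \<le> b\<close> _ cont'])
      show "(Q has_vector_derivative f t - m) (at t within {a..b})" for t
        unfolding Q_def
        by (rule derivative_eq_intros has_vector_derivative_at_within[OF P] | simp)+
    qed
    then have "ennreal (norm (Q b - Q a)) \<le> (\<integral>\<^sup>+t. ennreal (norm (?I t)) \<partial>lborel)"
      using integral_norm_bound_ennreal[OF borel_integrable_atLeastAtMost'[OF cont', unfolded set_integrable_def]]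
      by simp
    also have "\<dots> \<le> (\<integral>\<^sup>+t\<in>?K. ennreal (norm (f t - m)) \<partial>lborel)"
      using ab by (intro nn_integral_mono) (auto split: split_indicator)
    also have "\<dots> \<le> ennreal (2 * h) * ennreal N"
      using mean_oscillation_le_bmo_norm[of x "x + 2 * h" f] \<open>h > 0\<close> by (simp add: m_def N)
    finally show ?thesis
      using \<open>h > 0\<close> N by (simp flip: ennreal_mult)
  qed
  have "P (x + 2 * h) - 2 * P (x + h) + P x = (Q (x + 2 * h) - Q (x + h)) - (Q (x + h) - Q x)"
    by (simp add: Q_def algebra_simps)
  also have "norm \<dots> \<le> 2 * h * N + 2 * h * N"
  proof -
    have "norm (Q (x + 2 * h) - Q (x + h)) \<le> 2 * h * N" "norm (Q (x + h) - Q x) \<le> 2 * h * N"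
      using \<open>h > 0\<close> by (intro Q; simp)+
    then show ?thesis
      using norm_triangle_ineq4[of "Q (x + 2 * h) - Q (x + h)" "Q (x + h) - Q x"] by linarith
  qed
  finally show ?thesis by (simp add: N_def)
qed

section \<open>Derivatives of functions of exponential type\<close>

lemma entire_primitive_exp_growth:
  assumes hol: "f holomorphic_on UNIV" and "0 \<le> \<sigma>" and growth: "\<And>z. norm (f z) \<le> C * exp (\<sigma> * norm z)"
  obtains P D where "\<And>z. (P has_field_derivative f z) (at z)"
    and "\<And>z. norm (P z) \<le> D * exp ((\<sigma> + 1) * norm z)"
proof -
  obtain P where P: "\<And>z. (P has_field_derivative f z) (at z)"
    using holomorphic_convex_primitive'[OF convex_UNIV open_UNIV hol] by auto
  have "0 \<le> C"
    using growth[of 0] order_trans[OF norm_ge_zero] by fastforce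
  have "norm (P z) \<le> (norm (P 0) + C) * exp ((\<sigma> + 1) * norm z)" for z
  proof -
    have "norm (P z - P 0) \<le> C * exp (\<sigma> * norm z) * norm (z - 0)"
    proof (rule field_differentiable_bound[where S = "cball 0 (norm z)"])
      show "norm (f w) \<le> C * exp (\<sigma> * norm z)" if "w \<in> cball 0 (norm z)" for w
      proof -
        have "C * exp (\<sigma> * norm w) \<le> C * exp (\<sigma> * norm z)"
          using that \<open>0 \<le> C\<close> \<open>0 \<le> \<sigma>\<close> by (intro mult_left_mono) (auto intro: mult_left_mono)
        then show ?thesis using growth[of w] by linarith
      qed
    qed (auto intro: has_field_derivative_at_within P)
    also have "norm (z - 0) \<le> exp (norm z)"
      unfolding diff_zero using exp_ge_add_one_self[of "norm z"] by linarith
    finally have "norm (P z - P 0) \<le> C * exp (\<sigma> * norm z) * exp (norm z)"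
      using \<open>0 \<le> C\<close> by (simp add: mult_left_mono)
    also have "\<dots> = C * exp ((\<sigma> + 1) * norm z)"
      by (simp add: algebra_simps exp_add)
    finally have "norm (P z - P 0) \<le> C * exp ((\<sigma> + 1) * norm z)" .
    moreover have "norm (P 0) * 1 \<le> norm (P 0) * exp ((\<sigma> + 1) * norm z)"
      using \<open>0 \<le> \<sigma>\<close> by (intro mult_left_mono) auto
    ultimately show ?thesis
      using norm_triangle_ineq[of "P z - P 0" "P 0"] by (simp add: algebra_simps)
  qed
  then show ?thesis using P that by blast
qed

text \<open>On the line, the second difference bound \<open>B = 4hN\<close> of a primitive gives \<open>2 B / h\<^sup>2 = 8 N / h = 2160 (\<sigma> + 1) N\<close>,
  where \<open>N\<close> is the \<open>BMO\<close> norm. The rate is \<open>\<sigma> + 1\<close> there because a primitive grows like \<open>\<bar>z\<bar>\<close> times \<open>f\<close>. Off the line the bound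
  follows from the unweighted case \<open>\<epsilon> = 0\<close> of the Phragmen--Lindeloef principle.\<close>

lemma deriv_le_bmo_norm:
  assumes hol: "f holomorphic_on UNIV" and "0 \<le> \<sigma>" and growth: "\<And>z. norm (f z) \<le> C * exp (\<sigma> * norm z)"
    and fin: "bmo_norm_entire f < \<infinity>"
  shows "norm (deriv f z) \<le> 2160 * (\<sigma> + 1) * exp (\<sigma> * \<bar>Im z\<bar>) * enn2real (bmo_norm_entire f)"
proof -
  define N where "N = enn2real (bmo_norm_entire f)"
  define h where "h = 1 / (270 * (\<sigma> + 1))"
  have "h > 0" using \<open>0 \<le> \<sigma>\<close> by (simp add: h_def)
  obtain P D where P: "\<And>z. (P has_field_derivative f z) (at z)"
    and D: "\<And>z. norm (P z) \<le> D * exp ((\<sigma> + 1) * norm z)"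
    using entire_primitive_exp_growth[OF hol \<open>0 \<le> \<sigma>\<close> growth] by blast
  have P_hol: "P holomorphic_on UNIV"
    using P by (auto simp: holomorphic_on_open)
  have "deriv P = f"
    using P by (auto intro: DERIV_imp_deriv)
  then have P2: "(deriv ^^ 2) P = deriv f"
    by (simp add: numeral_2_eq_2)
  have line: "norm (deriv f (of_real x)) \<le> 2160 * (\<sigma> + 1) * N" for x :: real
  proof -
    have "norm ((deriv ^^ 2) P (of_real x)) \<le> 2 * (4 * h * N) / h\<^sup>2"
    proof (rule second_derivative_le_second_difference[OF P_hol _ h_def D])
      show "norm (P (of_real (x + 2 * h)) - 2 * P (of_real (x + h)) + P (of_real x)) \<le> 4 * h * N" for x
        unfolding N_def
      proof (rule second_difference_primitive_le_bmo_norm[OF _ _ fin \<open>h > 0\<close>])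
        show "continuous_on UNIV (\<lambda>t. f (complex_of_real t))"
          by (rule continuous_on_compose2[OF holomorphic_on_imp_continuous_on[OF hol]])
            (auto intro: continuous_intros)
        show "((\<lambda>t. P (complex_of_real t)) has_vector_derivative f (of_real t)) (at t)" for t
          using has_vector_derivative_real_field[OF P] by simp
      qed
    qed (use \<open>0 \<le> \<sigma>\<close> in simp)
    also have "\<dots> = 2160 * (\<sigma> + 1) * N"
      using \<open>h > 0\<close> \<open>0 \<le> \<sigma>\<close> by (simp add: h_def power2_eq_square)
    finally show ?thesis by (simp add: P2)
  qed
  have "norm (deriv f w) \<le> fact 1 * C * exp \<sigma> * exp (\<sigma> * norm w)" for w
    using exp_growth_higher_deriv[OF hol \<open>0 \<le> \<sigma>\<close> growth, of 1 w] by simp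
  from phragmen_lindelof_weighted[OF holomorphic_deriv[OF hol open_UNIV] order_refl this, of _ z 0]
  have "norm (deriv f z) \<le> 2160 * (\<sigma> + 1) * N * exp (\<sigma> * \<bar>Im z\<bar>)"
    using line by simp
  then show ?thesis by (simp add: N_def mult_ac)
qed

section \<open>The Paley--Wiener type space\<close>

lemma exp_type_leD:
  assumes "exp_type f \<le> ereal \<tau>" "\<tau> < \<sigma>"
  shows "f holomorphic_on UNIV" "\<exists>C. \<forall>z. norm (f z) \<le> C * exp (\<sigma> * norm z)"
proof -
  show "f holomorphic_on UNIV"
    using assms(1) by (auto simp: exp_type_def split: if_splits)
  then have "Inf {ereal \<beta> | \<beta>. \<exists>C::real. \<forall>z. norm (f z) \<le> C * exp (\<beta> * norm z)} < ereal \<sigma>"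
    using assms by (auto simp: exp_type_def intro: le_less_trans)
  then obtain \<beta> C where "\<beta> < \<sigma>" and C: "\<And>z. norm (f z) \<le> C * exp (\<beta> * norm z)"
    by (auto simp: Inf_less_iff) blast
  have "0 \<le> C"
    using C[of 0] order_trans[OF norm_ge_zero] by fastforce
  have "norm (f z) \<le> C * exp (\<sigma> * norm z)" for z
    using C[of z] mult_left_mono[of "exp (\<beta> * norm z)" "exp (\<sigma> * norm z)" C] \<open>0 \<le> C\<close> \<open>\<beta> < \<sigma>\<close>
    by (auto simp: mult_right_mono intro: order_trans)
  then show "\<exists>C. \<forall>z. norm (f z) \<le> C * exp (\<sigma> * norm z)" by blast
qed

lemma PW_star_deriv_bound:
  assumes "b > 0"
  obtains K \<sigma> where "K \<ge> 0" "\<sigma> \<ge> 0"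
    "\<And>f p z. f \<in> PW_star p b \<Longrightarrow> norm (deriv f z) \<le> K * exp (\<sigma> * \<bar>Im z\<bar>) * enn2real (bmo_norm_entire f)"
proof -
  define \<sigma> where "\<sigma> = pi * b + 1"
  have \<sigma>: "\<sigma> \<ge> 0" "pi * b < \<sigma>"
    using \<open>b > 0\<close> by (simp_all add: \<sigma>_def)
  have "norm (deriv f z) \<le> 2160 * (\<sigma> + 1) * exp (\<sigma> * \<bar>Im z\<bar>) * enn2real (bmo_norm_entire f)"
    if "f \<in> PW_star p b" for f p z
  proof -
    have f: "exp_type f \<le> ereal (pi * b)" "bmo_norm_entire f < \<infinity>"
      using that by (auto simp: PW_star_def bmo_norm_at_def)
    then show ?thesis
      using exp_type_leD[OF f(1) \<sigma>(2)] deriv_le_bmo_norm[OF _ \<sigma>(1) _ f(2)] by blast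
  qed
  then show ?thesis
    using \<sigma>(1) by (intro that[of "2160 * (\<sigma> + 1)" \<sigma>]) auto
qed

text \<open>Horizontal strips are convex, and the derivative is bounded on each of them. The
  constant \<open>K\<close> depends only on \<open>b\<close> and the width of the strip, and it is this uniformity in \<open>f\<close> that makes
  the norms for different base points equivalent.\<close>

lemma PW_star_oscillation_bound:
  assumes "b > 0"
  obtains K where "K \<ge> 0"
    "\<And>f p z w. f \<in> PW_star p b \<Longrightarrow> \<bar>Im z\<bar> \<le> R \<Longrightarrow> \<bar>Im w\<bar> \<le> R \<Longrightarrow>
       norm (f z - f w) \<le> K * enn2real (bmo_norm_entire f) * norm (z - w)"
proof -
  obtain K \<sigma> where K: "K \<ge> 0" "\<sigma> \<ge> 0"
    "\<And>f p z. f \<in> PW_star p b \<Longrightarrow> norm (deriv f z) \<le> K * exp (\<sigma> * \<bar>Im z\<bar>) * enn2real (bmo_norm_entire f)"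
    using PW_star_deriv_bound[OF assms] by metis
  have "norm (f z - f w) \<le> K * exp (\<sigma> * R) * enn2real (bmo_norm_entire f) * norm (z - w)"
    if f: "f \<in> PW_star p b" and zw: "\<bar>Im z\<bar> \<le> R" "\<bar>Im w\<bar> \<le> R" for f p z w
  proof (rule field_differentiable_bound[where S = "{z. Im z \<le> R} \<inter> {z. - R \<le> Im z}"])
    show "convex ({z. Im z \<le> R} \<inter> {z. - R \<le> Im z})"
      using convex_halfspace_Im_le convex_halfspace_Im_ge by (intro convex_Int) auto
    have "f holomorphic_on UNIV"
      using f by (auto simp: PW_star_def exp_type_def split: if_splits)
    then show "(f has_field_derivative deriv f u) (at u within {z. Im z \<le> R} \<inter> {z. - R \<le> Im z})" for u
      using holomorphic_derivI has_field_derivative_at_within by blast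
    show "norm (deriv f u) \<le> K * exp (\<sigma> * R) * enn2real (bmo_norm_entire f)"
      if "u \<in> {z. Im z \<le> R} \<inter> {z. - R \<le> Im z}" for u
    proof -
      have "\<bar>Im u\<bar> \<le> R" using that by auto
      then have "K * exp (\<sigma> * \<bar>Im u\<bar>) * enn2real (bmo_norm_entire f)
          \<le> K * exp (\<sigma> * R) * enn2real (bmo_norm_entire f)"
        using K(1,2) by (intro mult_right_mono mult_left_mono) (auto intro: mult_left_mono)
      then show ?thesis using K(3)[OF f, of u] by linarith
    qed
  qed (use zw in auto)
  then show ?thesis
    using K(1) by (intro that[of "K * exp (\<sigma> * R)"]) auto
qed

lemma bmo_norm_at_eq_ennreal:
  assumes "f \<in> PW_star p b"
  shows "bmo_norm_at c f = ennreal (norm (f c) + enn2real (bmo_norm_entire f))"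
  using assms by (simp add: PW_star_def bmo_norm_at_def ennreal_plus)

lemma bmo_norm_at_change_point:
  fixes c c' :: complex
  assumes "b > 0"
  obtains K where "K \<ge> 1" "\<And>f p. f \<in> PW_star p b \<Longrightarrow> bmo_norm_at c f \<le> ennreal K * bmo_norm_at c' f"
proof -
  obtain K where K: "K \<ge> 0" "\<And>f p z w. f \<in> PW_star p b \<Longrightarrow> \<bar>Im z\<bar> \<le> max \<bar>Im c\<bar> \<bar>Im c'\<bar> \<Longrightarrow>
      \<bar>Im w\<bar> \<le> max \<bar>Im c\<bar> \<bar>Im c'\<bar> \<Longrightarrow>
      norm (f z - f w) \<le> K * enn2real (bmo_norm_entire f) * norm (z - w)"
    using PW_star_oscillation_bound[OF assms, of "max \<bar>Im c\<bar> \<bar>Im c'\<bar>"] by metis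
  let ?L = "1 + K * norm (c - c')"
  have "bmo_norm_at c f \<le> ennreal ?L * bmo_norm_at c' f" if f: "f \<in> PW_star p b" for f p
  proof -
    let ?N = "enn2real (bmo_norm_entire f)"
    have "norm (f c - f c') \<le> K * ?N * norm (c - c')"
      by (rule K(2)[OF f]) auto
    moreover have "norm (f c) \<le> norm (f c') + norm (f c - f c')"
      using norm_triangle_ineq[of "f c'" "f c - f c'"] by simp
    moreover have "0 \<le> K * norm (c - c') * norm (f c')"
      using K(1) by simp
    ultimately have "norm (f c) + ?N \<le> ?L * (norm (f c') + ?N)"
      by (simp add: algebra_simps)
    then show ?thesis
      unfolding bmo_norm_at_eq_ennreal[OF f] using K(1)
      by (simp add: ennreal_mult[symmetric] del: ennreal_plus)
  qed
  then show ?thesis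
    using K(1) by (intro that[of ?L]) auto
qed

theorem theorem7:
  fixes b :: real and p :: complex
  assumes "b > 0"
  shows
    "(\<forall>f \<in> PW_star p b. \<forall>c::real. \<exists>L.
        L-lipschitz_on UNIV (\<lambda>t::real. f (complex_of_real t + \<i> * complex_of_real c)))
   \<and> (\<forall>c c'::complex. \<exists>C1 C2::real. C1 > 0 \<and> C2 > 0 \<and>
        (\<forall>f \<in> PW_star p b.
           ennreal C1 * bmo_norm_at c' f \<le> bmo_norm_at c f \<and>
           bmo_norm_at c f \<le> ennreal C2 * bmo_norm_at c' f))
   \<and> (\<forall>z::complex. \<exists>C::real. C \<ge> 0 \<and>
        (\<forall>f \<in> PW_star p b. ennreal (norm (f z)) \<le> ennreal C * bmo_norm_at p f))
   \<and> (\<exists>C::real. C \<ge> 0 \<and>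
        (\<forall>f \<in> PW_star p b.
           Linfty_norm (\<lambda>t. deriv f (complex_of_real t)) \<le> ennreal C * bmo_norm_entire f))"
proof (intro conjI allI ballI)
  fix f c
  assume f: "f \<in> PW_star p b"
  obtain K where K: "K \<ge> 0" "\<And>f p z w. f \<in> PW_star p b \<Longrightarrow> \<bar>Im z\<bar> \<le> \<bar>c\<bar> \<Longrightarrow> \<bar>Im w\<bar> \<le> \<bar>c\<bar> \<Longrightarrow>
      norm (f z - f w) \<le> K * enn2real (bmo_norm_entire f) * norm (z - w)"
    using PW_star_oscillation_bound[OF assms, of "\<bar>c\<bar>"] by metis
  show "\<exists>L. L-lipschitz_on UNIV (\<lambda>t::real. f (complex_of_real t + \<i> * complex_of_real c))"
  proof (intro exI lipschitz_onI)
    fix s t :: real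
    show "dist (f (of_real s + \<i> * of_real c)) (f (of_real t + \<i> * of_real c))
        \<le> K * enn2real (bmo_norm_entire f) * dist s t"
      using K(2)[OF f, of "of_real s + \<i> * of_real c" "of_real t + \<i> * of_real c"]
      by (simp add: dist_norm norm_of_real[of "s - t", where 'a = complex, simplified])
  qed (use K(1) in simp)
next
  fix c c' :: complex
  obtain K where K: "K \<ge> 1" "\<And>f p. f \<in> PW_star p b \<Longrightarrow> bmo_norm_at c f \<le> ennreal K * bmo_norm_at c' f"
    using bmo_norm_at_change_point[OF assms] by metis
  obtain K' where K': "K' \<ge> 1" "\<And>f p. f \<in> PW_star p b \<Longrightarrow> bmo_norm_at c' f \<le> ennreal K' * bmo_norm_at c f"
    using bmo_norm_at_change_point[OF assms] by metis
  have "ennreal (1 / K') * bmo_norm_at c' f \<le> bmo_norm_at c f" if f: "f \<in> PW_star p b" for f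
  proof -
    have "ennreal (1 / K') * bmo_norm_at c' f \<le> ennreal (1 / K') * (ennreal K' * bmo_norm_at c f)"
      using K'(2)[OF f] by (intro mult_left_mono) auto
    also have "\<dots> = bmo_norm_at c f"
      using K'(1) by (simp add: mult.assoc[symmetric] ennreal_mult[symmetric])
    finally show ?thesis .
  qed
  then show "\<exists>C1 C2::real. C1 > 0 \<and> C2 > 0 \<and> (\<forall>f \<in> PW_star p b.
      ennreal C1 * bmo_norm_at c' f \<le> bmo_norm_at c f \<and>
      bmo_norm_at c f \<le> ennreal C2 * bmo_norm_at c' f)"
    using K K'(1) by (intro exI[of _ "1 / K'"] exI[of _ K]) auto
next
  fix z :: complex
  obtain K where K: "K \<ge> 1" "\<And>f q. f \<in> PW_star q b \<Longrightarrow> bmo_norm_at z f \<le> ennreal K * bmo_norm_at p f"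
    using bmo_norm_at_change_point[OF assms] by metis
  have "ennreal (norm (f z)) \<le> ennreal K * bmo_norm_at p f" if "f \<in> PW_star p b" for f
    using K(2)[OF that] by (rule order_trans[rotated]) (simp add: bmo_norm_at_def)
  then show "\<exists>C::real. C \<ge> 0 \<and> (\<forall>f \<in> PW_star p b. ennreal (norm (f z)) \<le> ennreal C * bmo_norm_at p f)"
    using K(1) by (intro exI[of _ K]) auto
next
  obtain K \<sigma> where K: "K \<ge> 0" "\<And>f p z. f \<in> PW_star p b \<Longrightarrow>
      norm (deriv f z) \<le> K * exp (\<sigma> * \<bar>Im z\<bar>) * enn2real (bmo_norm_entire f)"
    using PW_star_deriv_bound[OF assms] by metis
  have "Linfty_norm (\<lambda>t. deriv f (complex_of_real t)) \<le> ennreal K * bmo_norm_entire f"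
    if f: "f \<in> PW_star p b" for f
    unfolding Linfty_norm_def
  proof (rule esssup_I)
    have "deriv f holomorphic_on UNIV"
      using f by (intro holomorphic_deriv) (auto simp: PW_star_def exp_type_def split: if_splits)
    then have "continuous_on UNIV (\<lambda>t. deriv f (complex_of_real t))"
      by (rule continuous_on_compose2[OF holomorphic_on_imp_continuous_on])
        (auto intro: continuous_intros)
    then have [measurable]: "(\<lambda>t. deriv f (complex_of_real t)) \<in> borel_measurable lborel"
      by (simp add: borel_measurable_continuous_onI)
    show "(\<lambda>t. ennreal (norm (deriv f (complex_of_real t)))) \<in> borel_measurable lborel"
      by measurable
    have "ennreal (norm (deriv f (of_real t))) \<le> ennreal K * bmo_norm_entire f" for t :: real
    proof -
      have "bmo_norm_entire f = ennreal (enn2real (bmo_norm_entire f))"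
        using f by (simp add: PW_star_def bmo_norm_at_def)
      moreover have "ennreal (norm (deriv f (of_real t))) \<le> ennreal (K * enn2real (bmo_norm_entire f))"
        using K(2)[OF f, of "of_real t"] by (intro ennreal_leI) simp
      ultimately show ?thesis
        using K(1) by (simp add: ennreal_mult)
    qed
    then show "AE t in lborel. ennreal (norm (deriv f (complex_of_real t))) \<le> ennreal K * bmo_norm_entire f"
      by simp
  qed
  then show "\<exists>C::real. C \<ge> 0 \<and> (\<forall>f \<in> PW_star p b.
      Linfty_norm (\<lambda>t. deriv f (complex_of_real t)) \<le> ennreal C * bmo_norm_entire f)"
    using K(1) by blast
qed

end
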